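(* Let $T,S\in\mathcal{B}_A(\mathcal{H})$. Then $$w_A^2(T+S)\leq \frac{1}{2}\left(\left\|T^{\sharp_A} T+S^{\sharp_A} S\right\|_A+\left\|T^{\sharp_A} T-S^{\sharp_A} S\right\|_A\right)+\sqrt{w_A(T^{\sharp_A} T)\,w_A(S^{\sharp_A} S)}+2w_A(S^{\sharp_A} T).$$
   Context: $(\mathcal{H},\langle\cdot,\cdot\rangle)$ is a nontrivial complex Hilbert space, $\mathcal{B}(\mathcal{H})$ is the algebra of bounded linear operators on $\mathcal{H}$, and $A\in\mathcal{B}(\mathcal{H})$ is a positive operator, i.e. $\langle Ax,x\rangle\ge 0$ for all $x\in\mathcal{H}$. The semi-inner product induced by $A$ is $\langle x,y\rangle_A=\langle Ax,y\rangle$, with seminorm $\|x\|_A=\sqrt{\langle x,x\rangle_A}$ on $\mathcal{H}$. $\mathcal{B}_A(\mathcal{H})=\{T\in\mathcal{B}(\mathcal{H}): \operatorname{ran}(T^*A)\subseteq\operatorname{ran}(A)\}$ is the set of operators admitting an $A$-adjoint. For $T\in\mathcal{B}_A(\mathcal{H})$, $T^{\sharp_A}=A^{\dagger}T^*A$ (with $A^\dagger$ the Moore-Penrose inverse of $A$) is the unique bounded solution $X$ of $AX=T^*A$ whose range is contained in $\overline{\operatorname{ran}(A)}$; it satisfies $\langle Tx,y\rangle_A=\langle x,T^{\sharp_A}y\rangle_A$ for all $x,y\in\mathcal{H}$. For $T\in\mathcal{B}_A(\mathcal{H})$, the $A$-operator seminorm is $\|T\|_A=\sup\{\|Tx\|_A: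 x\in\mathcal{H},\ \|x\|_A=1\}$ and the $A$-numerical radius is $w_A(T)=\sup\{|\langle Tx,x\rangle_A|: x\in\mathcal{H},\ \|x\|_A=1\}$; $w_A^2(T)$ means $(w_A(T))^2$. *)

theory Defs
  imports "HOL-Analysis.Analysis"
begin

text \<open>
  Complex Hilbert spaces, with the inner product linear in its first argument. The real inner
  product inherited from \<open>real_inner\<close> is the real part of the complex one; positive definiteness,
  \<open>norm x = sqrt (Re (cinner x x))\<close> and the topology are thereby inherited as well.
\<close>

class complex_hilbert = real_inner + complete_space +
  fixes scaleC :: "complex \<Rightarrow> 'a \<Rightarrow> 'a"
    and cinner :: "'a \<Rightarrow> 'a \<Rightarrow> complex"
  assumes scaleC_add_right: "scaleC a (x + y) = scaleC a x + scaleC a y"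
    and scaleC_add_left: "scaleC (a + b) x = scaleC a x + scaleC b x"
    and scaleC_scaleC: "scaleC a (scaleC b x) = scaleC (a * b) x"
    and scaleC_of_real: "scaleC (complex_of_real r) x = scaleR r x"
    and cinner_commute: "cinner x y = cnj (cinner y x)"
    and cinner_add_left: "cinner (x + y) z = cinner x z + cinner y z"
    and cinner_scaleC_left: "cinner (scaleC a x) y = a * cinner x y"
    and Re_cinner: "Re (cinner x y) = inner x y"

definition bounded_clinear :: "('a::complex_hilbert \<Rightarrow> 'a) \<Rightarrow> bool" where
  "bounded_clinear T \<longleftrightarrow> bounded_linear T \<and> (\<forall>c x. T (scaleC c x) = scaleC c (T x))"

definition positive_operator :: "('a::complex_hilbert \<Rightarrow> 'a) \<Rightarrow> bool" where
  "positive_operator A \<longleftrightarrow> bounded_clinear A \<and> (\<forall>x. cinner (A x) x \<in> \<real>\<^sub>\<ge>\<^sub>0)"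

definition hilbert_adjoint :: "('a::complex_hilbert \<Rightarrow> 'a) \<Rightarrow> 'a \<Rightarrow> 'a" where
  "hilbert_adjoint T = (THE R. \<forall>x y. cinner (T x) y = cinner x (R y))"

text \<open>
  The Moore-Penrose inverse of \<open>A\<close> is an operator with domain
  \<open>ran A + (ran A)\<^sup>\<bottom>\<close>, which need not be the whole space. It maps \<open>y\<close> to the unique \<open>x\<close>
  in the orthogonal complement of \<open>ker A\<close> such that \<open>y - A x\<close> is orthogonal to \<open>ran A\<close>.
  Outside its domain the value below is unspecified.
\<close>

definition moore_penrose :: "('a::complex_hilbert \<Rightarrow> 'a) \<Rightarrow> 'a \<Rightarrow> 'a" where
  "moore_penrose A y =
     (THE x. (\<forall>z. A z = 0 \<longrightarrow> cinner x z = 0) \<and> (\<forall>z. cinner (y - A x) (A z) = 0))"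

definition A_inner :: "('a::complex_hilbert \<Rightarrow> 'a) \<Rightarrow> 'a \<Rightarrow> 'a \<Rightarrow> complex" where
  "A_inner A x y = cinner (A x) y"

definition A_norm :: "('a::complex_hilbert \<Rightarrow> 'a) \<Rightarrow> 'a \<Rightarrow> real" where
  "A_norm A x = sqrt (Re (A_inner A x x))"

definition A_adjointable :: "('a::complex_hilbert \<Rightarrow> 'a) \<Rightarrow> ('a \<Rightarrow> 'a) set" where
  "A_adjointable A = {T. bounded_clinear T \<and> range (hilbert_adjoint T \<circ> A) \<subseteq> range A}"

definition A_adjoint :: "('a::complex_hilbert \<Rightarrow> 'a) \<Rightarrow> ('a \<Rightarrow> 'a) \<Rightarrow> 'a \<Rightarrow> 'a" where
  "A_adjoint A T = moore_penrose A \<circ> hilbert_adjoint T \<circ> A"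

text \<open>
  The suprema are taken in the nonnegative reals, so the supremum of the empty set is 0. This matters
  only for \<open>A = 0\<close>, when no vector has \<open>A\<close>-seminorm 1; \<open>Sup {}\<close> is unspecified for type \<open>real\<close>.
\<close>

definition Sup_nonneg :: "real set \<Rightarrow> real" where
  "Sup_nonneg X = (if X = {} then 0 else Sup X)"

definition A_opnorm :: "('a::complex_hilbert \<Rightarrow> 'a) \<Rightarrow> ('a \<Rightarrow> 'a) \<Rightarrow> real" where
  "A_opnorm A T = Sup_nonneg {A_norm A (T x) |x. A_norm A x = 1}"

definition A_numradius :: "('a::complex_hilbert \<Rightarrow> 'a) \<Rightarrow> ('a \<Rightarrow> 'a) \<Rightarrow> real" where
  "A_numradius A T = Sup_nonneg {cmod (A_inner A (T x) x) |x. A_norm A x = 1}"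

end

theory Submission
  imports Defs
begin

text \<open>
  Write \<open>P\<close> and \<open>Q\<close> for the compositions of \<open>T\<close> and \<open>S\<close> with their \<open>A\<close>-adjoints, and let \<open>x\<close>
  have \<open>A\<close>-seminorm 1. With \<open>a = (A_norm A (T x))\<^sup>2\<close> and \<open>b = (A_norm A (S x))\<^sup>2\<close>, Cauchy-Schwarz for
  the semi-inner product bounds \<open>(cmod (A_inner A (T x + S x) x))\<^sup>2\<close> by
  \<open>(A_norm A (T x + S x))\<^sup>2 = a + b + 2 * Re (A_inner A (T x) (S x))\<close>.
  Here \<open>a\<close> and \<open>b\<close> are the values of the forms of \<open>P\<close> and \<open>Q\<close> at \<open>x\<close>, and the mixed term is a value
  of the form of \<open>A_adjoint A S \<circ> T\<close>. The inequality follows by writing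
  \<open>a + b = ((a + b) + \<bar>a - b\<bar>) / 2 + min a b\<close>, using \<open>min a b \<le> sqrt (a * b)\<close>, and bounding \<open>a + b\<close>
  and \<open>\<bar>a - b\<bar>\<close> by the seminorms of \<open>P + Q\<close> and \<open>P - Q\<close>.

  The work lies in showing that the quantities on the right dominate the individual values, because
  a real supremum does so only over a bounded set: operators that admit an
  \<open>A\<close>-adjoint must be bounded for the \<open>A\<close>-seminorm. This comes in two steps. The uniform boundedness
  principle, applied to the factorisation \<open>hilbert_adjoint T \<circ> A = A \<circ> A_adjoint A T\<close>, bounds \<open>T\<close>, and
  then \<open>P\<close>, for the seminorm \<open>norm (A x)\<close> (\<open>norm_A_comp_bounded\<close>). As \<open>P\<close> is symmetric for the semi-inner
  product, iterating it turns this into a bound with the same constant for \<open>A_norm A x\<close>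
  (\<open>A_symmetric_bound\<close>). The factorisation rests in turn on orthogonal projections onto closed
  subspaces, which give the Hilbert space adjoint by Riesz' theorem and the values of the
  Moore-Penrose inverse on the range of \<open>A\<close>.
\<close>

section \<open>Real Hilbert spaces\<close>

text \<open>
  A minimising sequence for the distance from \<open>x\<close> to \<open>M\<close> is Cauchy by the parallelogram law, and
  minimality of the limit \<open>p\<close> against \<open>p + t m\<close> for all real \<open>t\<close> kills the linear term in \<open>t\<close>.
\<close>

lemma ex_orthogonal_projection:
  fixes M :: "'a::{real_inner,complete_space} set"
  assumes "subspace M" "closed M"
  obtains p where "p \<in> M" "\<And>m. m \<in> M \<Longrightarrow> inner (x - p) m = 0"
proof -
  let ?X = "(\<lambda>m. (norm (x - m))\<^sup>2) ` M"
  define D where "D = Inf ?X"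
  have M0: "0 \<in> M" using assms(1) by (rule subspace_0)
  have bdd: "bdd_below ?X" by (rule bdd_belowI[of _ 0]) auto
  have D_le: "D \<le> (norm (x - m))\<^sup>2" if "m \<in> M" for m
    unfolding D_def using bdd that by (intro cInf_lower) auto
  have "\<exists>m\<in>M. (norm (x - m))\<^sup>2 < D + inverse (real (Suc n))" for n
    using cInf_lessD[of ?X "D + inverse (real (Suc n))"] M0 unfolding D_def by auto
  then obtain y where yM: "\<And>n. y n \<in> M"
    and y: "\<And>n. (norm (x - y n))\<^sup>2 < D + inverse (real (Suc n))" by metis
  have close: "(norm (y m - y n))\<^sup>2 \<le> 2 * inverse (real (Suc m)) + 2 * inverse (real (Suc n))"
    for m n
  proof -
    have "(1/2) *\<^sub>R (y m + y n) \<in> M"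
      by (intro subspace_scale subspace_add assms yM)
    from D_le[OF this] have "D \<le> (norm (x - (1/2) *\<^sub>R (y m + y n)))\<^sup>2" .
    moreover have "(norm (y m - y n))\<^sup>2 = 2 * (norm (x - y m))\<^sup>2 + 2 * (norm (x - y n))\<^sup>2
        - 4 * (norm (x - (1/2) *\<^sub>R (y m + y n)))\<^sup>2"
      unfolding power2_norm_eq_inner
      by (simp add: inner_diff_left inner_diff_right inner_add_left inner_add_right
          inner_commute algebra_simps)
    ultimately show ?thesis using y[of m] y[of n] by linarith
  qed
  have "Cauchy y"
  proof (rule CauchyI)
    fix e :: real assume e: "e > 0"
    then obtain N where N: "inverse (real (Suc N)) < e\<^sup>2 / 4"
      using reals_Archimedean[of "e\<^sup>2 / 4"] by auto
    have "norm (y m - y n) < e" if "m \<ge> N" "n \<ge> N" for m n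
    proof -
      have "inverse (real (Suc k)) < e\<^sup>2 / 4" if "k \<ge> N" for k
        using N that by (meson le_less_trans le_imp_inverse_le of_nat_le_iff of_nat_0_less_iff
            Suc_le_mono zero_less_Suc)
      from this[OF that(1)] this[OF that(2)] close[of m n]
      have "(norm (y m - y n))\<^sup>2 < e\<^sup>2" by linarith
      then show ?thesis using e by (simp add: power2_less_imp_less)
    qed
    then show "\<exists>N. \<forall>m\<ge>N. \<forall>n\<ge>N. norm (y m - y n) < e" by blast
  qed
  then obtain p where p: "y \<longlonglongrightarrow> p"
    using Cauchy_convergent_iff convergent_def by blast
  have pM: "p \<in> M"
    using closed_sequentially[OF assms(2) _ p] yM by blast
  have "(norm (x - p))\<^sup>2 \<le> D + 0"
  proof (rule LIMSEQ_le)
    show "(\<lambda>n. (norm (x - y n))\<^sup>2) \<longlonglongrightarrow> (norm (x - p))\<^sup>2"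
      by (intro tendsto_intros p)
    show "(\<lambda>n. D + inverse (real (Suc n))) \<longlonglongrightarrow> D + 0"
      by (intro tendsto_intros LIMSEQ_inverse_real_of_nat)
    show "\<exists>N. \<forall>n\<ge>N. (norm (x - y n))\<^sup>2 \<le> D + inverse (real (Suc n))"
      using y less_imp_le by blast
  qed
  then have minimal: "(norm (x - p))\<^sup>2 \<le> (norm (x - q))\<^sup>2" if "q \<in> M" for q
    using D_le[OF that] by linarith
  have "inner (x - p) m = 0" if m: "m \<in> M" for m
  proof (cases "m = 0")
    case False
    define c where "c = inner (x - p) m"
    \<comment> \<open>the value of \<open>t\<close> at which \<open>norm (x - p - t m)\<close> is least\<close>
    define t where "t = c / inner m m"
    have mm: "inner m m > 0" using False by simp
    have "p + t *\<^sub>R m \<in> M" using assms(1) pM m by (simp add: subspace_add subspace_scale)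
    from minimal[OF this]
    have "inner (x - p) (x - p) \<le> inner ((x - p) - t *\<^sub>R m) ((x - p) - t *\<^sub>R m)"
      by (simp add: power2_norm_eq_inner diff_diff_eq)
    also have "\<dots> = inner (x - p) (x - p) - 2 * t * c + t * t * inner m m"
      unfolding c_def by (simp only: inner_diff_left[of "x - p" "t *\<^sub>R m"]
          inner_diff_right[of _ "x - p" "t *\<^sub>R m"] inner_scaleR_left inner_scaleR_right
          inner_commute[of m "x - p"]) (simp add: algebra_simps)
    also have "\<dots> = inner (x - p) (x - p) - c\<^sup>2 / inner m m"
      using mm by (simp add: t_def power2_eq_square field_simps)
    finally have "c\<^sup>2 / inner m m \<le> 0" by simp
    then have "c\<^sup>2 \<le> 0" using mm by (simp add: divide_le_0_iff)
    then show ?thesis by (simp add: c_def)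
  qed simp
  with pM show thesis by (rule that)
qed

lemma riesz_representation:
  fixes f :: "'a::{real_inner,complete_space} \<Rightarrow> real"
  assumes f: "bounded_linear f"
  obtains z where "\<And>x. f x = inner x z"
proof (cases "\<forall>x. f x = 0")
  case True
  then show thesis using that[of 0] by simp
next
  case False
  interpret f: bounded_linear f by (rule f)
  from False obtain u where u: "f u \<noteq> 0" by auto
  have "subspace {x. f x = 0}"
    by (auto simp: subspace_def f.add f.scaleR f.zero)
  moreover have "closed {x. f x = 0}"
    by (intro closed_Collect_eq continuous_intros linear_continuous_on f)
  ultimately obtain p where p: "f p = 0" "\<And>m. f m = 0 \<Longrightarrow> inner (u - p) m = 0"
    using ex_orthogonal_projection[of "{x. f x = 0}" u] by auto
  \<comment> \<open>\<open>v\<close> spans the orthogonal complement of the kernel, so \<open>f\<close> is a multiple of its pairing\<close>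
  define v where "v = u - p"
  have fv: "f v \<noteq> 0" using u p(1) by (simp add: v_def f.diff)
  then have vv: "inner v v \<noteq> 0" using f.zero by auto
  have "f x = inner x ((f v / inner v v) *\<^sub>R v)" for x
  proof -
    have "f (x - (f x / f v) *\<^sub>R v) = 0" using fv by (simp add: f.diff f.scaleR)
    from p(2)[OF this] have "inner v x = f x / f v * inner v v"
      by (simp add: v_def[symmetric] inner_diff_right)
    then show ?thesis using fv vv by (simp add: inner_commute field_simps)
  qed
  then show thesis by (rule that)
qed

text \<open>
  The uniform boundedness principle for functionals. By Baire one of the closed sets
  \<open>E n = {y. \<forall>w\<in>W. \<bar>inner y w\<bar> \<le> n}\<close> contains a ball. Subtracting
  its centre from the point of its boundary in the direction of \<open>w\<close> bounds \<open>norm w\<close>.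
\<close>

lemma weakly_bounded_imp_bounded:
  fixes W :: "'a::{real_inner,complete_space} set"
  assumes "\<And>y. \<exists>B. \<forall>w\<in>W. \<bar>inner y w\<bar> \<le> B"
  shows "\<exists>C\<ge>0. \<forall>w\<in>W. norm w \<le> C"
proof -
  define E where "E n = {y. \<forall>w\<in>W. \<bar>inner y w\<bar> \<le> real n}" for n
  have closedE: "closed (E n)" for n
  proof -
    have "E n = (\<Inter>w\<in>W. {y. \<bar>inner y w\<bar> \<le> real n})" by (auto simp: E_def)
    also have "closed \<dots>" by (intro closed_INT ballI closed_Collect_le continuous_intros)
    finally show ?thesis .
  qed
  have "y \<in> (\<Union>n. E n)" for y
  proof -
    obtain B where "\<forall>w\<in>W. \<bar>inner y w\<bar> \<le> B" using assms by blast
    moreover obtain n where "B \<le> real n" using real_arch_simple by blast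
    ultimately have "y \<in> E n" by (force simp: E_def)
    then show ?thesis by blast
  qed
  then have cover: "(\<Union>n. E n) = UNIV" by blast
  have "\<exists>n. interior (E n) \<noteq> {}"
  proof (rule ccontr)
    assume "\<not> ?thesis"
    then have "(euclidean interior_of \<Union> (range E)) = {}"
      using closedE
      by (intro Baire_category_alt)
        (auto simp: completely_metrizable_space_euclidean)
    then show False using cover by simp
  qed
  then obtain n y where "y \<in> interior (E n)" by blast
  then obtain e where e: "e > 0" "cball y e \<subseteq> E n"
    using mem_interior_cball by blast
  have "norm w \<le> 2 * real n / e" if w: "w \<in> W" for w
  proof (cases "w = 0")
    case False
    define u where "u = (e / norm w) *\<^sub>R w"
    have "norm u = e" using e False by (simp add: u_def)
    then have "y + u \<in> E n" "y \<in> E n" using e by (auto simp: dist_norm subset_iff)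
    then have "\<bar>inner (y + u) w\<bar> \<le> real n" "\<bar>inner y w\<bar> \<le> real n"
      using w by (auto simp: E_def)
    then have "inner u w \<le> 2 * real n" by (simp add: inner_add_left)
    moreover have "inner u w = e * norm w"
      using False by (simp add: u_def dot_square_norm power2_eq_square)
    ultimately show ?thesis using e by (simp add: field_simps)
  qed (use e in simp)
  moreover have "0 \<le> 2 * real n / e" using e by simp
  ultimately show ?thesis by blast
qed

section \<open>Growth of log-convex sequences\<close>

text \<open>
  Log-convexity makes the ratios \<open>a (Suc n) / a n\<close> increase, so a first ratio above \<open>D\<close> would force
  growth faster than the assumed \<open>D ^ n\<close>.
\<close>

lemma log_convex_first_ratio_le:
  fixes a :: "nat \<Rightarrow> real"
  assumes nonneg: "\<And>n. 0 \<le> a n" and D: "0 \<le> D"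
    and convex: "\<And>n. (a (Suc n))\<^sup>2 \<le> a n * a (Suc (Suc n))"
    and growth: "\<And>n. (a n)\<^sup>2 \<le> K * (D\<^sup>2) ^ n"
  shows "a 1 \<le> D * a 0"
proof (rule ccontr)
  assume "\<not> ?thesis"
  then have less: "D * a 0 < a 1" by simp
  have a1: "a 1 > 0" using less D nonneg[of 0] by (meson le_less_trans mult_nonneg_nonneg)
  have a0: "a 0 > 0"
  proof (rule ccontr)
    assume "\<not> ?thesis"
    then have "a 0 = 0" using nonneg[of 0] by simp
    then show False using convex[of 0] a1 by simp
  qed
  have Dpos: "D > 0"
  proof (rule ccontr)
    assume "\<not> ?thesis"
    then have "D = 0" using D by simp
    then show False using growth[of 1] a1 by simp
  qed
  define r where "r = a 1 / a 0"
  have rD: "r > D" using less a0 by (simp add: r_def field_simps)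
  have step: "0 < a n \<and> r * a n \<le> a (Suc n)" for n
  proof (induction n)
    case 0
    then show ?case using a0 by (simp add: r_def)
  next
    case (Suc n)
    have pos: "0 < a (Suc n)"
      using Suc rD Dpos by (meson less_le_trans less_trans mult_pos_pos)
    have "a n * (r * a (Suc n)) = (r * a n) * a (Suc n)" by simp
    also have "\<dots> \<le> a (Suc n) * a (Suc n)" using Suc pos by (intro mult_right_mono) auto
    also have "\<dots> \<le> a n * a (Suc (Suc n))" using convex[of n] by (simp add: power2_eq_square)
    finally show ?case using Suc pos by simp
  qed
  have lower: "r ^ n * a 0 \<le> a n" for n
  proof (induction n)
    case (Suc n)
    have "r ^ Suc n * a 0 = r * (r ^ n * a 0)" by simp
    also have "\<dots> \<le> r * a n" using Suc rD Dpos by (intro mult_left_mono) auto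
    finally show ?case using step[of n] by simp
  qed simp
  have "(r\<^sup>2 / D\<^sup>2) ^ n \<le> K / (a 0)\<^sup>2" for n
  proof -
    have "(r ^ n * a 0)\<^sup>2 \<le> (a n)\<^sup>2"
      using lower[of n] rD Dpos a0 by (intro power_mono) auto
    also note growth[of n]
    finally have "(r\<^sup>2) ^ n * (a 0)\<^sup>2 \<le> K * (D\<^sup>2) ^ n"
      by (simp add: power_mult_distrib power_mult[symmetric] mult.commute)
    then show ?thesis using Dpos a0 by (simp add: power_divide field_simps)
  qed
  moreover have "1 < r\<^sup>2 / D\<^sup>2" using rD Dpos by (simp add: power_strict_mono)
  ultimately show False using real_arch_pow[of "r\<^sup>2 / D\<^sup>2" "K / (a 0)\<^sup>2"]
    by (meson not_le)
qed

section \<open>The complex inner product and the adjoint\<close>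

lemma cinner_scaleC_right: "cinner x (scaleC a y) = cnj a * cinner x y"
  by (metis cinner_commute cinner_scaleC_left complex_cnj_mult)

lemma inner_scaleC_left: "inner (scaleC a x) y = inner x (scaleC (cnj a) y)"
  by (simp add: Re_cinner[symmetric] cinner_scaleC_left cinner_scaleC_right)

lemma Im_cinner: "Im (cinner x y) = inner (scaleC (- \<i>) x) y"
  by (simp add: Re_cinner[symmetric] cinner_scaleC_left)

lemma scaleC_one: "scaleC 1 x = x"
  using scaleC_of_real[of 1 x] by simp

lemma scaleC_minus_one: "scaleC (- 1) x = - x"
  using scaleC_of_real[of "-1" x] by simp

lemma bounded_clinear_bounded_linear: "bounded_clinear T \<Longrightarrow> bounded_linear T"
  by (simp add: bounded_clinear_def)

lemma bounded_clinear_scaleC: "bounded_clinear T \<Longrightarrow> T (scaleC c x) = scaleC c (T x)"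
  by (simp add: bounded_clinear_def)

text \<open>
  Complex linearity turns the real part of the identity at \<open>-\<i> x\<close> into its imaginary part at \<open>x\<close>.
\<close>

lemma cinner_eq_of_inner_eq:
  assumes "bounded_clinear T" "\<And>x. inner (T x) y = inner x z"
  shows "cinner (T x) y = cinner x z"
proof (rule complex_eqI)
  show "Re (cinner (T x) y) = Re (cinner x z)"
    by (simp add: Re_cinner assms(2))
  show "Im (cinner (T x) y) = Im (cinner x z)"
    by (simp add: Im_cinner bounded_clinear_scaleC[OF assms(1), symmetric] assms(2))
qed

lemma cinner_hilbert_adjoint:
  assumes T: "bounded_clinear T"
  shows "cinner (T x) y = cinner x (hilbert_adjoint T y)"
proof -
  have "\<exists>z. \<forall>x. inner (T x) y = inner x z" for y
  proof -
    have "bounded_linear (\<lambda>x. inner (T x) y)"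
      by (rule bounded_linear_compose[OF bounded_linear_inner_left
            bounded_clinear_bounded_linear[OF T]])
    then show ?thesis by (metis riesz_representation)
  qed
  then obtain R where "\<And>x y. inner (T x) y = inner x (R y)" by metis
  then have R: "\<forall>x y. cinner (T x) y = cinner x (R y)"
    using cinner_eq_of_inner_eq[OF T] by blast
  have "R' = R" if R': "\<forall>x y. cinner (T x) y = cinner x (R' y)" for R'
  proof
    fix y
    have "\<forall>x. inner x (R' y) = inner x (R y)"
      using R R' by (metis Re_cinner)
    then show "R' y = R y" by (simp only: vector_eq_ldot)
  qed
  with R have "\<exists>!R. \<forall>x y. cinner (T x) y = cinner x (R y)" by blast
  from theI'[OF this] show ?thesis unfolding hilbert_adjoint_def by blast
qed

lemma inner_hilbert_adjoint:
  "bounded_clinear T \<Longrightarrow> inner (T x) y = inner x (hilbert_adjoint T y)"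
  by (metis Re_cinner cinner_hilbert_adjoint)

lemma norm_hilbert_adjoint_le:
  assumes "bounded_clinear T"
  shows "norm (hilbert_adjoint T v) \<le> onorm T * norm v"
proof (cases "hilbert_adjoint T v = 0")
  case True
  then show ?thesis
    by (simp add: onorm_pos_le bounded_clinear_bounded_linear[OF assms])
next
  case False
  let ?w = "hilbert_adjoint T v"
  have "norm ?w * norm ?w = inner (T ?w) v"
    by (simp add: inner_hilbert_adjoint[OF assms] dot_square_norm power2_eq_square)
  also have "\<dots> \<le> norm (T ?w) * norm v" by (rule norm_cauchy_schwarz)
  also have "\<dots> \<le> (onorm T * norm ?w) * norm v"
    by (intro mult_right_mono onorm bounded_clinear_bounded_linear assms) simp
  finally have "norm ?w * norm ?w \<le> norm ?w * (onorm T * norm v)" by (simp add: mult_ac)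
  then show ?thesis using False by simp
qed

section \<open>The semi-inner product of a positive operator\<close>

context
  fixes A :: "'a::complex_hilbert \<Rightarrow> 'a"
  assumes A: "positive_operator A"
begin

lemma positive_operator_bounded_clinear: "bounded_clinear A"
  using A by (simp add: positive_operator_def)

interpretation A: bounded_linear A
  by (rule bounded_clinear_bounded_linear[OF positive_operator_bounded_clinear])

lemma Re_A_inner: "Re (A_inner A x y) = inner (A x) y"
  by (simp add: A_inner_def Re_cinner)

lemma positive_operator_inner_nonneg: "0 \<le> inner (A x) x"
  using A by (auto simp: positive_operator_def Re_cinner[symmetric] complex_nonneg_Reals_iff)

text \<open>
  The diagonal values are real, and the imaginary part of the one at \<open>x + \<i> y\<close> contains the
  difference of the two sides.
\<close>

lemma positive_operator_symmetric: "inner (A x) y = inner x (A y)"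
proof -
  have real_diag: "Im (cinner (A u) u) = 0" for u
    using A by (auto simp: positive_operator_def complex_nonneg_Reals_iff)
  have "Im (cinner (A (x + scaleC \<i> y)) (x + scaleC \<i> y)) =
      Im (cinner (A x) x) + Im (cinner (A y) y) - inner (A x) y + inner (A y) x"
    by (simp add: A.add bounded_clinear_scaleC[OF positive_operator_bounded_clinear] Im_cinner
        scaleC_add_right inner_add_left inner_add_right inner_scaleC_left scaleC_scaleC
        scaleC_one scaleC_minus_one)
  then show ?thesis by (simp add: real_diag inner_commute)
qed

lemma A_norm_nonneg: "0 \<le> A_norm A x"
  by (simp add: A_norm_def Re_A_inner positive_operator_inner_nonneg)

lemma A_norm_power2: "(A_norm A x)\<^sup>2 = inner (A x) x"
  by (simp add: A_norm_def Re_A_inner positive_operator_inner_nonneg)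

lemma A_norm_scaleC:
  assumes "cmod c = 1"
  shows "A_norm A (scaleC c x) = A_norm A x"
proof -
  have "cnj c * c = 1"
    using assms by (metis complex_norm_square mult.commute of_real_1 one_power2)
  then show ?thesis
    by (simp add: A_norm_def Re_A_inner inner_scaleC_left scaleC_scaleC
      bounded_clinear_scaleC[OF positive_operator_bounded_clinear] scaleC_one)
qed

lemma inner_A_le: "\<bar>inner (A x) y\<bar> \<le> A_norm A x * A_norm A y"
proof -
  let ?a = "inner (A x) x" and ?b = "inner (A x) y" and ?c = "inner (A y) y"
  have quadratic: "0 \<le> ?a + 2 * t * ?b + t\<^sup>2 * ?c" for t
  proof -
    have "inner (A (x + t *\<^sub>R y)) (x + t *\<^sub>R y) = ?a + 2 * t * ?b + t\<^sup>2 * ?c"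
      using positive_operator_symmetric[of y x]
      by (simp add: A.add A.scaleR inner_add_left inner_add_right inner_commute
          power2_eq_square algebra_simps)
    then show ?thesis using positive_operator_inner_nonneg by metis
  qed
  have "?b\<^sup>2 \<le> ?a * ?c"
  proof (cases "?c = 0")
    case True
    have "?b = 0"
    proof (rule ccontr)
      assume "?b \<noteq> 0"
      then show False using quadratic[of "- (?a + 1) / (2 * ?b)"] True by (simp add: field_simps)
    qed
    then show ?thesis using True by simp
  next
    case False
    then have "?c > 0" using positive_operator_inner_nonneg[of y] by simp
    then show ?thesis using quadratic[of "- ?b / ?c"]
      by (simp add: field_simps power2_eq_square)
  qed
  also have "\<dots> = (A_norm A x * A_norm A y)\<^sup>2" by (simp add: power_mult_distrib A_norm_power2)
  finally show ?thesis
    using abs_le_square_iff[of ?b "A_norm A x * A_norm A y"]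
    by (simp add: abs_mult A_norm_nonneg)
qed

text \<open>A rotation of \<open>x\<close> makes the complex value real and nonnegative.\<close>

lemma cmod_A_inner_le: "cmod (A_inner A x y) \<le> A_norm A x * A_norm A y"
proof (cases "A_inner A x y = 0")
  case True
  then show ?thesis by (simp add: A_norm_nonneg)
next
  case False
  define c where "c = cnj (sgn (A_inner A x y))"
  have c: "cmod c = 1" using False by (simp add: c_def norm_sgn)
  have "c * A_inner A x y = cmod (A_inner A x y)"
    using False unfolding c_def sgn_eq
    by (simp add: complex_norm_square[symmetric] power2_eq_square mult.commute field_simps)
  moreover have "A_inner A (scaleC c x) y = c * A_inner A x y"
    by (simp add: A_inner_def cinner_scaleC_left
        bounded_clinear_scaleC[OF positive_operator_bounded_clinear])
  ultimately have "cmod (A_inner A x y) = inner (A (scaleC c x)) y"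
    by (metis Re_A_inner Re_complex_of_real)
  also have "\<dots> \<le> A_norm A (scaleC c x) * A_norm A y" using inner_A_le abs_le_D1 by blast
  finally show ?thesis by (simp add: A_norm_scaleC[OF c])
qed

lemma A_norm_triangle: "A_norm A (x + y) \<le> A_norm A x + A_norm A y"
proof (rule power2_le_imp_le)
  have "(A_norm A (x + y))\<^sup>2 = (A_norm A x)\<^sup>2 + (A_norm A y)\<^sup>2 + 2 * inner (A x) y"
    using positive_operator_symmetric[of y x]
    by (simp add: A_norm_power2 A.add inner_add_left inner_add_right inner_commute)
  also have "\<dots> \<le> (A_norm A x)\<^sup>2 + (A_norm A y)\<^sup>2 + 2 * (A_norm A x * A_norm A y)"
    using inner_A_le[of x y] by simp
  finally show "(A_norm A (x + y))\<^sup>2 \<le> (A_norm A x + A_norm A y)\<^sup>2"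
    by (simp add: power2_sum)
qed (simp add: A_norm_nonneg)

lemma A_norm_minus: "A_norm A (- x) = A_norm A x"
  by (simp add: A_norm_def Re_A_inner A.neg)

section \<open>The adjoint with respect to the semi-inner product\<close>

text \<open>
  On the range of \<open>A\<close> the Moore-Penrose inverse is genuinely a right inverse: it subtracts from a
  preimage its projection onto the closed subspace \<open>ker A\<close>.
\<close>

lemma A_moore_penrose:
  assumes "y \<in> range A"
  shows "A (moore_penrose A y) = y"
proof -
  let ?P = "\<lambda>x. (\<forall>z. A z = 0 \<longrightarrow> cinner x z = 0) \<and> (\<forall>z. cinner (y - A x) (A z) = 0)"
  from assms obtain z where z: "y = A z" by blast
  have solves: "A x = y" if "?P x" for x
  proof -
    have "cinner (y - A x) (A (z - x)) = 0" using that by blast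
    then have "inner (y - A x) (y - A x) = 0"
      by (simp add: Re_cinner[symmetric] z A.diff)
    then show ?thesis by simp
  qed
  have "subspace {x. A x = 0}" by (auto simp: subspace_def A.add A.scaleR A.zero)
  moreover have "closed {x. A x = 0}"
    by (intro closed_Collect_eq continuous_intros linear_continuous_on A.bounded_linear_axioms)
  ultimately obtain p where p: "A p = 0" "\<And>m. A m = 0 \<Longrightarrow> inner (z - p) m = 0"
    using ex_orthogonal_projection[of "{x. A x = 0}" z] by auto
  have "cinner (z - p) m = 0" if "A m = 0" for m
  proof (rule complex_eqI)
    have "A (scaleC \<i> m) = scaleC \<i> 0"
      using that by (simp add: bounded_clinear_scaleC[OF positive_operator_bounded_clinear])
    also have "\<dots> = 0" by (metis add_cancel_right_right scaleC_add_right add.right_neutral)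
    finally show "Im (cinner (z - p) m) = Im 0"
      by (simp add: Im_cinner inner_scaleC_left p(2))
  qed (simp add: Re_cinner p(2) that)
  moreover have "cinner 0 v = 0" for v :: 'a
    using cinner_add_left[of 0 0 v] by simp
  ultimately have ex: "?P (z - p)" by (simp add: A.diff p(1) z)
  have unique: "x = x'" if x: "?P x" and x': "?P x'" for x x'
  proof -
    have "A (x - x') = 0" using solves[OF x] solves[OF x'] by (simp add: A.diff)
    then have "cinner x (x - x') = 0" "cinner x' (x - x') = 0" using x x' by blast+
    then have "inner (x - x') (x - x') = 0"
      by (metis Re_cinner inner_diff_left diff_self)
    then show ?thesis by simp
  qed
  have "\<exists>!x. ?P x" using ex unique by blast
  from theI'[OF this] show ?thesis
    using solves by (simp add: moore_penrose_def)
qed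

context
  fixes T :: "'a \<Rightarrow> 'a"
  assumes T: "T \<in> A_adjointable A"
begin

lemma A_adjointable_bounded_clinear: "bounded_clinear T"
  using T by (simp add: A_adjointable_def)

lemma A_A_adjoint: "A (A_adjoint A T x) = hilbert_adjoint T (A x)"
  using T A_moore_penrose[of "hilbert_adjoint T (A x)"]
  by (auto simp: A_adjointable_def A_adjoint_def)

lemma A_inner_A_adjoint: "A_inner A (A_adjoint A T x) y = A_inner A x (T y)"
proof -
  have "A_inner A (A_adjoint A T x) y = cnj (cinner y (hilbert_adjoint T (A x)))"
    unfolding A_inner_def A_A_adjoint by (rule cinner_commute)
  also have "\<dots> = cnj (cinner (T y) (A x))"
    by (simp add: cinner_hilbert_adjoint[OF A_adjointable_bounded_clinear])
  also have "\<dots> = A_inner A x (T y)"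
    unfolding A_inner_def by (rule cinner_commute[symmetric])
  finally show ?thesis .
qed

lemma inner_A_A_adjoint: "inner (A (A_adjoint A T x)) y = inner (A x) (T y)"
  by (metis A_inner_A_adjoint Re_A_inner)

text \<open>
  Boundedness for the seminorm \<open>norm (A x)\<close>, from the uniform boundedness principle.
  The factorisation \<open>hilbert_adjoint T \<circ> A = A \<circ> A_adjoint A T\<close> bounds the vectors \<open>A (T w)\<close>
  with \<open>norm (A w) \<le> 1\<close> weakly: pairing with \<open>y\<close> gives \<open>inner (A_adjoint A T y) (A w)\<close>.
\<close>

lemma norm_A_comp_bounded:
  obtains C where "0 \<le> C" "\<And>x. norm (A (T x)) \<le> C * norm (A x)"
proof -
  let ?W = "{A (T w) |w. norm (A w) \<le> 1}"
  have dual: "inner y (A (T w)) = inner (A_adjoint A T y) (A w)" for y w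
    using inner_A_A_adjoint[of y w] by (simp add: positive_operator_symmetric)
  have "\<exists>B. \<forall>v\<in>?W. \<bar>inner y v\<bar> \<le> B" for y
  proof (intro exI ballI)
    fix v assume "v \<in> ?W"
    then obtain w where w: "v = A (T w)" "norm (A w) \<le> 1" by blast
    have "\<bar>inner y v\<bar> \<le> norm (A_adjoint A T y) * norm (A w)"
      unfolding w dual by (rule Cauchy_Schwarz_ineq2)
    also have "\<dots> \<le> norm (A_adjoint A T y) * 1" using w by (intro mult_left_mono) auto
    finally show "\<bar>inner y v\<bar> \<le> norm (A_adjoint A T y)" by simp
  qed
  from weakly_bounded_imp_bounded[OF this]
  obtain C where C: "0 \<le> C" "\<forall>v\<in>?W. norm v \<le> C" by blast
  interpret T: bounded_linear T
    by (rule bounded_clinear_bounded_linear[OF A_adjointable_bounded_clinear])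
  have "norm (A (T x)) \<le> C * norm (A x)" for x
  proof (cases "A x = 0")
    case True
    have "inner (A (T x)) (A (T x)) = 0"
      using dual[of "A (T x)" x] True by simp
    then show ?thesis using True by simp
  next
    case False
    let ?w = "(1 / norm (A x)) *\<^sub>R x"
    have "norm (A ?w) \<le> 1" using False by (simp add: A.scaleR)
    then have "norm (A (T ?w)) \<le> C" using C(2) by blast
    then show ?thesis using False by (simp add: A.scaleR T.scaleR field_simps)
  qed
  with C(1) show thesis by (rule that)
qed

end

text \<open>
  The numbers \<open>A_norm A ((P ^^ n) x)\<close> form a log-convex sequence because \<open>P\<close> is symmetric for the
  semi-inner product; their squares are \<open>inner (A ((P ^^ (2 * n)) x)) x\<close>, which grows no faster than
  \<open>D ^ (2 * n)\<close>. Hence the first ratio is at most \<open>D\<close>.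
\<close>

lemma A_symmetric_bound:
  assumes sym: "\<And>x y. inner (A (P x)) y = inner (A x) (P y)"
    and D: "0 \<le> D" "\<And>x. norm (A (P x)) \<le> D * norm (A x)"
  shows "A_norm A (P x) \<le> D * A_norm A x"
proof -
  define a where "a n = A_norm A ((P ^^ n) x)" for n
  have iter_sym: "inner (A ((P ^^ n) u)) v = inner (A u) ((P ^^ n) v)" for n u v
  proof (induction n arbitrary: v)
    case (Suc n)
    have "inner (A ((P ^^ Suc n) u)) v = inner (A ((P ^^ n) u)) (P v)" by (simp add: sym)
    also have "\<dots> = inner (A u) ((P ^^ n) (P v))" by (rule Suc)
    finally show ?case by (simp only: funpow_Suc_right comp_apply)
  qed simp
  have iter_norm: "norm (A ((P ^^ n) u)) \<le> D ^ n * norm (A u)" for n u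
  proof (induction n)
    case (Suc n)
    have "norm (A ((P ^^ Suc n) u)) \<le> D * norm (A ((P ^^ n) u))" using D(2) by simp
    also have "\<dots> \<le> D * (D ^ n * norm (A u))" by (intro mult_left_mono Suc D(1))
    finally show ?case by (simp add: mult_ac)
  qed simp
  have "a 1 \<le> D * a 0"
  proof (rule log_convex_first_ratio_le[where K = "norm (A x) * norm x"])
    fix n
    show "0 \<le> a n" by (simp add: a_def A_norm_nonneg)
    have "(a (Suc n))\<^sup>2 = inner (A ((P ^^ n) x)) ((P ^^ Suc (Suc n)) x)"
      unfolding a_def A_norm_power2 by (simp add: sym)
    also have "\<dots> \<le> a n * a (Suc (Suc n))"
      unfolding a_def using inner_A_le abs_le_D1 by blast
    finally show "(a (Suc n))\<^sup>2 \<le> a n * a (Suc (Suc n))" .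
    have "(a n)\<^sup>2 = inner (A ((P ^^ (n + n)) x)) x"
      unfolding a_def A_norm_power2 funpow_add by (simp add: iter_sym)
    also have "\<dots> \<le> norm (A ((P ^^ (n + n)) x)) * norm x" by (rule norm_cauchy_schwarz)
    also have "\<dots> \<le> (D ^ (n + n) * norm (A x)) * norm x"
      by (intro mult_right_mono iter_norm) simp
    finally show "(a n)\<^sup>2 \<le> (norm (A x) * norm x) * (D\<^sup>2) ^ n"
      by (simp add: power_mult[symmetric] mult_2 mult_2_right mult_ac)
  qed (rule D(1))
  then show ?thesis by (simp add: a_def)
qed

text \<open>
  With \<open>P = A_adjoint A T \<circ> T\<close> the vector \<open>A (P x)\<close> equals \<open>hilbert_adjoint T (A (T x))\<close>, so the bound on
  \<open>A (T x)\<close> by \<open>A x\<close> carries over to \<open>P\<close>, which is symmetric.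
\<close>

lemma A_norm_A_adjoint_comp_bounded:
  assumes T: "T \<in> A_adjointable A"
  obtains D where "0 \<le> D" "\<And>x. A_norm A (A_adjoint A T (T x)) \<le> D * A_norm A x"
proof -
  note clin = A_adjointable_bounded_clinear[OF T]
  obtain C where C: "0 \<le> C" "\<And>x. norm (A (T x)) \<le> C * norm (A x)"
    using norm_A_comp_bounded[OF T] by blast
  have onorm0: "0 \<le> onorm T" by (intro onorm_pos_le bounded_clinear_bounded_linear clin)
  have "A_norm A (A_adjoint A T (T x)) \<le> (onorm T * C) * A_norm A x" for x
  proof (rule A_symmetric_bound)
    fix x y
    show "inner (A (A_adjoint A T (T x))) y = inner (A x) (A_adjoint A T (T y))"
      by (metis inner_A_A_adjoint[OF T] inner_commute positive_operator_symmetric)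
    have "norm (A (A_adjoint A T (T x))) \<le> onorm T * norm (A (T x))"
      by (simp add: A_A_adjoint[OF T] norm_hilbert_adjoint_le[OF clin])
    also have "\<dots> \<le> onorm T * (C * norm (A x))" by (intro mult_left_mono C(2) onorm0)
    finally show "norm (A (A_adjoint A T (T x))) \<le> (onorm T * C) * norm (A x)"
      by (simp add: mult_ac)
  qed (simp add: C(1) onorm0)
  moreover have "0 \<le> onorm T * C" by (simp add: C(1) onorm0)
  ultimately show thesis using that by blast
qed

lemma A_norm_power2_A_adjointable:
  assumes "T \<in> A_adjointable A"
  shows "(A_norm A (T x))\<^sup>2 = inner (A (A_adjoint A T (T x))) x"
  by (simp add: A_norm_power2 inner_A_A_adjoint[OF assms])

lemma A_norm_comp_bounded:
  assumes T: "T \<in> A_adjointable A"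
  obtains C where "0 \<le> C" "\<And>x. A_norm A (T x) \<le> C * A_norm A x"
proof -
  obtain D where D: "0 \<le> D" "\<And>x. A_norm A (A_adjoint A T (T x)) \<le> D * A_norm A x"
    using A_norm_A_adjoint_comp_bounded[OF T] by blast
  have "A_norm A (T x) \<le> sqrt D * A_norm A x" for x
  proof (rule power2_le_imp_le)
    have "(A_norm A (T x))\<^sup>2 \<le> A_norm A (A_adjoint A T (T x)) * A_norm A x"
      unfolding A_norm_power2_A_adjointable[OF T] using inner_A_le abs_le_D1 by blast
    also have "\<dots> \<le> (D * A_norm A x) * A_norm A x"
      by (intro mult_right_mono D(2) A_norm_nonneg)
    finally show "(A_norm A (T x))\<^sup>2 \<le> (sqrt D * A_norm A x)\<^sup>2"
      using D(1) by (simp add: power_mult_distrib) (simp add: power2_eq_square mult_ac)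
  qed (simp add: D(1) A_norm_nonneg)
  moreover have "0 \<le> sqrt D" using D(1) by simp
  ultimately show thesis using that by blast
qed

section \<open>The seminorm and the numerical radius as suprema\<close>

text \<open>
  The supremum of an unbounded set of reals is unspecified, hence the bound \<open>C\<close>.
\<close>

lemma A_norm_le_A_opnorm:
  assumes "\<And>x. A_norm A x = 1 \<Longrightarrow> A_norm A (R x) \<le> C" and x: "A_norm A x = 1"
  shows "A_norm A (R x) \<le> A_opnorm A R"
proof -
  have "A_norm A (R x) \<le> Sup {A_norm A (R x) |x. A_norm A x = 1}"
    using assms by (intro cSup_upper bdd_aboveI[of _ C]) auto
  then show ?thesis using x by (auto simp: A_opnorm_def Sup_nonneg_def)
qed

lemma cmod_A_inner_le_A_numradius:
  assumes "\<And>x. A_norm A x = 1 \<Longrightarrow> cmod (A_inner A (R x) x) \<le> C" and x: "A_norm A x = 1"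
  shows "cmod (A_inner A (R x) x) \<le> A_numradius A R"
proof -
  have "cmod (A_inner A (R x) x) \<le> Sup {cmod (A_inner A (R x) x) |x. A_norm A x = 1}"
    using assms by (intro cSup_upper bdd_aboveI[of _ C]) auto
  then show ?thesis using x by (auto simp: A_numradius_def Sup_nonneg_def)
qed

lemma A_numradius_power2_le:
  assumes bound: "\<And>x. A_norm A x = 1 \<Longrightarrow> (cmod (A_inner A (R x) x))\<^sup>2 \<le> K"
    and ex: "\<exists>x. A_norm A x = 1"
  shows "(A_numradius A R)\<^sup>2 \<le> K"
proof -
  have K: "0 \<le> K" using ex bound by (meson order_trans zero_le_power2)
  have le: "cmod (A_inner A (R x) x) \<le> sqrt K" if "A_norm A x = 1" for x
    using bound[OF that] by (rule real_le_rsqrt)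
  have "A_numradius A R \<le> sqrt K"
    using ex le unfolding A_numradius_def Sup_nonneg_def by (auto intro!: cSup_least)
  moreover obtain x where "A_norm A x = 1" using ex by blast
  then have "0 \<le> A_numradius A R"
    using cmod_A_inner_le_A_numradius[OF le] norm_ge_zero order_trans by blast
  ultimately have "(A_numradius A R)\<^sup>2 \<le> (sqrt K)\<^sup>2" by (rule power_mono)
  then show ?thesis using K by simp
qed

end

text \<open>
  The half sum plus half the gap is \<open>max a b\<close>, and the geometric mean dominates \<open>min a b\<close>.
\<close>

lemma add_le_half_sum_half_diff_sqrt:
  fixes a b :: real
  assumes "0 \<le> a" "0 \<le> b"
  shows "a + b \<le> 1 / 2 * ((a + b) + \<bar>a - b\<bar>) + sqrt (a * b)"
proof -
  have "min a b = sqrt (min a b * min a b)" using assms by simp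
  also have "\<dots> \<le> sqrt (a * b)"
    using assms by (intro real_sqrt_le_mono mult_mono) auto
  finally show ?thesis by (simp add: min_def abs_if split: if_splits)
qed

theorem theorem4p7:
  fixes A T S :: "'a::complex_hilbert \<Rightarrow> 'a"
  assumes "\<exists>v::'a. v \<noteq> 0"
    and "positive_operator A"
    and "T \<in> A_adjointable A"
    and "S \<in> A_adjointable A"
  shows "(A_numradius A (\<lambda>x. T x + S x))\<^sup>2 \<le>
      1 / 2 * (A_opnorm A (\<lambda>x. (A_adjoint A T \<circ> T) x + (A_adjoint A S \<circ> S) x)
             + A_opnorm A (\<lambda>x. (A_adjoint A T \<circ> T) x - (A_adjoint A S \<circ> S) x))
      + sqrt (A_numradius A (A_adjoint A T \<circ> T) * A_numradius A (A_adjoint A S \<circ> S))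
      + 2 * A_numradius A (A_adjoint A S \<circ> T)"
proof (cases "\<exists>x. A_norm A x = 1")
  case False
  \<comment> \<open>the degenerate case \<open>A = 0\<close>, where every supremum is over the empty set\<close>
  then show ?thesis by (simp add: A_numradius_def A_opnorm_def Sup_nonneg_def)
next
  case True
  note A = assms(2) and T = assms(3) and S = assms(4)
  let ?P = "\<lambda>x. A_adjoint A T (T x)" and ?Q = "\<lambda>x. A_adjoint A S (S x)"
  interpret A: bounded_linear A
    by (rule bounded_clinear_bounded_linear[OF positive_operator_bounded_clinear[OF A]])
  obtain D E where "\<And>x. A_norm A (?P x) \<le> D * A_norm A x"
      and "\<And>x. A_norm A (?Q x) \<le> E * A_norm A x"
    by (metis A_norm_A_adjoint_comp_bounded[OF A T] A_norm_A_adjoint_comp_bounded[OF A S])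
  then have D: "A_norm A (?P x) \<le> D" and E: "A_norm A (?Q x) \<le> E" if "A_norm A x = 1" for x
    using that by (metis mult.right_neutral)+
  obtain F G where "\<And>x. A_norm A (T x) \<le> F * A_norm A x" and "0 \<le> F"
      and "\<And>x. A_norm A (S x) \<le> G * A_norm A x"
    by (metis A_norm_comp_bounded[OF A T] A_norm_comp_bounded[OF A S])
  then have F: "A_norm A (T x) \<le> F" and G: "A_norm A (S x) \<le> G" and "0 \<le> F"
    if "A_norm A x = 1" for x
    using that by (metis mult.right_neutral)+
  show ?thesis
  proof (rule A_numradius_power2_le[OF A _ True])
    fix x assume x: "A_norm A x = 1"
    define a where "a = (A_norm A (T x))\<^sup>2"
    define b where "b = (A_norm A (S x))\<^sup>2"
    have a: "a = inner (A (?P x)) x" and b: "b = inner (A (?Q x)) x"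
      by (simp_all add: a_def b_def A_norm_power2_A_adjointable[OF A] T S)
    have "cmod (A_inner A (T x + S x) x) \<le> A_norm A (T x + S x)"
      using cmod_A_inner_le[OF A, of "T x + S x" x] x by simp
    then have "(cmod (A_inner A (T x + S x) x))\<^sup>2 \<le> (A_norm A (T x + S x))\<^sup>2"
      by (intro power_mono) auto
    also have "\<dots> = a + b + 2 * inner (A (T x)) (S x)"
      using positive_operator_symmetric[OF A, of "S x" "T x"]
      by (simp add: a_def b_def A_norm_power2[OF A] A.add inner_add_left inner_add_right
          inner_commute)
    also have "a + b \<le> 1 / 2 * ((a + b) + \<bar>a - b\<bar>) + sqrt (a * b)"
      by (rule add_le_half_sum_half_diff_sqrt) (simp_all add: a_def b_def)
    also have "a + b \<le> A_opnorm A (\<lambda>x. ?P x + ?Q x)"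
    proof -
      have "A_norm A (?P y + ?Q y) \<le> D + E" if "A_norm A y = 1" for y
        using A_norm_triangle[OF A, of "?P y" "?Q y"] D[OF that] E[OF that] by linarith
      note A_norm_le_A_opnorm[OF A, where R = "\<lambda>x. ?P x + ?Q x", OF this x]
      moreover have "\<bar>a + b\<bar> \<le> A_norm A (?P x + ?Q x)"
        using inner_A_le[OF A, of "?P x + ?Q x" x] x by (simp add: a b A.add inner_add_left)
      ultimately show ?thesis by linarith
    qed
    also have "\<bar>a - b\<bar> \<le> A_opnorm A (\<lambda>x. ?P x - ?Q x)"
    proof -
      have "A_norm A (?P y - ?Q y) \<le> D + E" if "A_norm A y = 1" for y
        using A_norm_triangle[OF A, of "?P y" "- ?Q y"] D[OF that] E[OF that]
        by (simp add: A_norm_minus[OF A])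
      note A_norm_le_A_opnorm[OF A, where R = "\<lambda>x. ?P x - ?Q x", OF this x]
      moreover have "\<bar>a - b\<bar> \<le> A_norm A (?P x - ?Q x)"
        using inner_A_le[OF A, of "?P x - ?Q x" x] x by (simp add: a b A.diff inner_diff_left)
      ultimately show ?thesis by linarith
    qed
    also have "sqrt (a * b) \<le> sqrt (A_numradius A ?P * A_numradius A ?Q)"
    proof (intro real_sqrt_le_mono mult_mono)
      have "cmod (A_inner A (?P y) y) \<le> D" if "A_norm A y = 1" for y
        using cmod_A_inner_le[OF A, of "?P y" y] D[OF that] that by simp
      from cmod_A_inner_le_A_numradius[OF A, where R = "?P", OF this x]
      show "a \<le> A_numradius A ?P"
        using complex_Re_le_cmod[of "A_inner A (?P x) x"] by (simp add: a Re_A_inner[OF A])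
      then show "0 \<le> A_numradius A ?P" using a_def by (meson order_trans zero_le_power2)
      have "cmod (A_inner A (?Q y) y) \<le> E" if "A_norm A y = 1" for y
        using cmod_A_inner_le[OF A, of "?Q y" y] E[OF that] that by simp
      from cmod_A_inner_le_A_numradius[OF A, where R = "?Q", OF this x]
      show "b \<le> A_numradius A ?Q"
        using complex_Re_le_cmod[of "A_inner A (?Q x) x"] by (simp add: b Re_A_inner[OF A])
    qed (simp add: b_def)
    also have "inner (A (T x)) (S x) \<le> A_numradius A (\<lambda>x. A_adjoint A S (T x))"
    proof -
      have "cmod (A_inner A (A_adjoint A S (T y)) y) \<le> F * G" if y: "A_norm A y = 1" for y
      proof -
        have "cmod (A_inner A (A_adjoint A S (T y)) y) \<le> A_norm A (T y) * A_norm A (S y)"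
          unfolding A_inner_A_adjoint[OF A S] by (rule cmod_A_inner_le[OF A])
        also have "\<dots> \<le> F * G" using F G y \<open>0 \<le> F\<close> by (intro mult_mono A_norm_nonneg A) auto
        finally show ?thesis .
      qed
      from cmod_A_inner_le_A_numradius[OF A, where R = "\<lambda>x. A_adjoint A S (T x)", OF this x]
      show ?thesis
        using complex_Re_le_cmod[of "A_inner A (A_adjoint A S (T x)) x"]
        by (simp add: Re_A_inner[OF A] inner_A_A_adjoint[OF A S])
    qed
    finally show "(cmod (A_inner A (T x + S x) x))\<^sup>2 \<le>
        1 / 2 * (A_opnorm A (\<lambda>x. (A_adjoint A T \<circ> T) x + (A_adjoint A S \<circ> S) x)
             + A_opnorm A (\<lambda>x. (A_adjoint A T \<circ> T) x - (A_adjoint A S \<circ> S) x))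
        + sqrt (A_numradius A (A_adjoint A T \<circ> T) * A_numradius A (A_adjoint A S \<circ> S))
        + 2 * A_numradius A (A_adjoint A S \<circ> T)"
      by (simp add: o_def)
  qed
qed

end
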